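(* Consider the $t$-indexed extreme shock model with possibly increasing threshold described in the context. Suppose that $$\lim_{t\to\infty}\frac{\bar F(\beta(t))}{\bar F(\gamma(t))}=g\in[0,1]\qquad\text{and}\qquad \lim_{t\to\infty}\frac{\bar F(\alpha(t)+b_k(t)-c_l(t))}{\bar F(\beta(t))}=a_{k,l}\in[0,1]\quad\text{for all }k,l\ge0 .$$ Then for any integers $k\ge0$ and $l\ge0$, $$P\{N_+(\nu)=k,\,N_-(\nu)=l\}\ \longrightarrow\ g(1-g)^k\prod_{h=0}^{l-1}(1-a_{k,h})\;a_{k,l}\qquad (t\to\infty),$$ where the empty product equals $1$.
   Context: Let $X_1,X_2,\dots$ be i.i.d. real random variables (shock magnitudes), with $F(x)=P\{X_1<x\}$ and $\bar F(x)=1-F(x)=P\{X_1\ge x\}$; let $x_F\le\infty$ be the upper endpoint of the distribution, assumed to be a continuity point of $F$. Convention: $0^0=1$. For each $t$ let $\gamma=\gamma(t)\le\beta=\beta(t)\le\alpha=\alpha(t)$ be real numbers, with $\bar F(\beta(t))>0$, and all three tending to $x_F$ as $t\to\infty$ (so $\bar F(\beta(t))\to0$). For each $t$ let $(b_k)_{k\ge0}=(b_k(t))$ and $(c_l)_{l\ge0}=(c_l(t))$ be nondecreasing real sequences with $b_0=c_0=0$, $b_1>0$, such that $\alpha_{k,l}:=\alpha+b_k-c_l\ge\beta$ for all $k,l\ge0$. For each $t$ define recursively $N_-(0)=N_+(0)=0$ and, for $n\ge1$, the number of weakening shocks before the $n$-th shock $$N_-(n)=\sum_{1\le i<n}1\{X_i\in[\beta,\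 \alpha+b_{N_+(i)}-c_{N_-(i)})\},$$ and the number of strengthening shocks before the $n$-th shock (and before the first weakening shock) $$N_+(n)=\sum_{1\le i<n}1\{X_i\in[\gamma,\beta),\ N_-(i)=0\}.$$ The index of the first fatal shock is $\nu=\nu(t)=\min\{i\ge1:X_i\ge\alpha+b_{N_+(i)}-c_{N_-(i)}\}$ (with value $\infty$ if the set is empty). Events involving $N_\pm(\nu)$ are understood to be intersected with $\{\nu<\infty\}$. The dependence of $\nu,N_+,N_-$ on $t$ is suppressed in the notation. *)

theory Defs
  imports "HOL-Probability.Probability"
begin

definition dist_fun :: "'a measure \<Rightarrow> ('a \<Rightarrow> real) \<Rightarrow> real \<Rightarrow> real" where
  "dist_fun M Y x = measure M {\<omega> \<in> space M. Y \<omega> < x}"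
  (* strict inequality: left-continuous version, unlike cdf in HOL-Probability *)

definition tail_fun :: "'a measure \<Rightarrow> ('a \<Rightarrow> real) \<Rightarrow> real \<Rightarrow> real" where
  "tail_fun M Y x = 1 - dist_fun M Y x"

definition upper_endpoint :: "'a measure \<Rightarrow> ('a \<Rightarrow> real) \<Rightarrow> ereal" where
  "upper_endpoint M Y = (SUP x \<in> {x. dist_fun M Y x < 1}. ereal x)"

(* Throughout, x i is the magnitude of the i-th shock, i >= 1; x 0 is never used.
   The value 0 at n = 0 and n = 1 comes from the empty sum. *)
fun N_minus :: "real \<Rightarrow> real \<Rightarrow> real \<Rightarrow> (nat \<Rightarrow> real) \<Rightarrow> (nat \<Rightarrow> real) \<Rightarrow> (nat \<Rightarrow> real) \<Rightarrow> nat \<Rightarrow> nat"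
  and N_plus :: "real \<Rightarrow> real \<Rightarrow> real \<Rightarrow> (nat \<Rightarrow> real) \<Rightarrow> (nat \<Rightarrow> real) \<Rightarrow> (nat \<Rightarrow> real) \<Rightarrow> nat \<Rightarrow> nat"
where
  "N_minus \<alpha> \<beta> \<gamma> b c x n = (\<Sum>i\<in>{1..<n}.
     of_bool (x i \<in> {\<beta>..<\<alpha> + b (N_plus \<alpha> \<beta> \<gamma> b c x i) - c (N_minus \<alpha> \<beta> \<gamma> b c x i)}))"
| "N_plus \<alpha> \<beta> \<gamma> b c x n = (\<Sum>i\<in>{1..<n}.
     of_bool (x i \<in> {\<gamma>..<\<beta>} \<and> N_minus \<alpha> \<beta> \<gamma> b c x i = 0))"

(* The defining equations are unconditional recursions and would loop as simp rules. *)
declare N_minus.simps [simp del] N_plus.simps [simp del]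

(* Inf {} = \<infinity> in enat, so the value is \<infinity> when no shock is fatal. *)
definition first_fatal ::
  "real \<Rightarrow> real \<Rightarrow> real \<Rightarrow> (nat \<Rightarrow> real) \<Rightarrow> (nat \<Rightarrow> real) \<Rightarrow> (nat \<Rightarrow> real) \<Rightarrow> enat" where
  "first_fatal \<alpha> \<beta> \<gamma> b c x = Inf (enat ` {i. 1 \<le> i \<and>
     \<alpha> + b (N_plus \<alpha> \<beta> \<gamma> b c x i) - c (N_minus \<alpha> \<beta> \<gamma> b c x i) \<le> x i})"

end

theory Submission
  imports Defs
begin

text \<open>
  For every fixed \<open>t\<close> the probability can be computed exactly. Let \<open>u\<^sub>n\<close> be the probability that
  the first \<open>n - 1\<close> shocks are not fatal and lead to \<open>N\<^sub>+ = k\<close> and \<open>N\<^sub>- = l\<close>. Splitting according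
  to the last shock gives a recursion \<open>u\<^bsub>n+1\<^esub> = r u\<^sub>n + v\<^sub>n\<close> with \<open>0 \<le> r < 1\<close>, where \<open>v\<close> comes from
  the predecessor state \<open>(k - 1, 0)\<close> or \<open>(k, l - 1)\<close>. Summation over \<open>n\<close> turns this into
  \<open>(1 - r) U = u\<^sub>1 + V\<close>. With \<open>p\<close> and \<open>q k l\<close> the two ratios of tails at \<open>t\<close> that tend to
  \<open>g\<close> and \<open>a k l\<close>, the probability is therefore \<open>p (1 - p)\<^sup>k (\<Prod>h<l. 1 - q k h) q k l\<close>.
\<close>

section \<open>Series whose terms obey an affine recursion\<close>

text \<open>Summing the recursion gives \<open>(1 - r) S_n = u 0 + V_n - u n\<close> for the partial
  sums. As \<open>u n\<close> is nonnegative, \<open>S_n\<close> is bounded; so the series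
  converges, \<open>u n\<close> tends to 0, and the limit can be taken in the identity.\<close>

lemma sums_affine_recursion:
  fixes u v :: "nat \<Rightarrow> real"
  assumes r: "0 \<le> r" "r < 1"
    and u: "\<And>n. 0 \<le> u n"
    and v: "\<And>n. 0 \<le> v n" "v sums V"
    and rec: "\<And>n. u (Suc n) = r * u n + v n"
  shows "u sums ((u 0 + V) / (1 - r))"
proof -
  have sum_v: "(\<Sum>i<n. v i) \<le> V" for n
    using v sums_unique sums_summable sum_le_suminf by (metis finite_lessThan)
  have eq: "(\<Sum>i<n. u i) * (1 - r) = u 0 + (\<Sum>i<n. v i) - u n" for n
  proof (induction n)
    case (Suc n)
    then show ?case
      unfolding sum.lessThan_Suc rec by algebra
  qed simp
  have "(\<Sum>i<n. u i) \<le> (u 0 + V) / (1 - r)" for n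
    using eq[of n] sum_v[of n] u[of n] r by (simp add: pos_le_divide_eq)
  then have "summable u"
    using u by (intro summableI_nonneg_bounded)
  then have "u \<longlonglongrightarrow> 0" and sums: "(\<lambda>n. \<Sum>i<n. u i) \<longlonglongrightarrow> suminf u"
    using summable_LIMSEQ_zero summable_LIMSEQ by auto
  then have "(\<lambda>n. u 0 + (\<Sum>i<n. v i) - u n) \<longlonglongrightarrow> u 0 + V - 0"
    using v(2) unfolding sums_def by (intro tendsto_intros)
  moreover have "(\<lambda>n. u 0 + (\<Sum>i<n. v i) - u n) \<longlonglongrightarrow> suminf u * (1 - r)"
    unfolding eq[symmetric] by (intro tendsto_intros sums)
  ultimately have "suminf u * (1 - r) = u 0 + V"
    using LIMSEQ_unique by fastforce
  then show ?thesis
    using \<open>summable u\<close> r by (simp add: sums_iff field_simps)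
qed

section \<open>Deterministic transitions of the shock counters\<close>

text \<open>The counters keep running after a fatal shock, so survival is recorded besides their
  values. The range stops before \<open>n\<close>, whose shock is still to be judged.\<close>

definition shock_state ::
  "real \<Rightarrow> real \<Rightarrow> real \<Rightarrow> (nat \<Rightarrow> real) \<Rightarrow> (nat \<Rightarrow> real) \<Rightarrow> (nat \<Rightarrow> real) \<Rightarrow> nat \<Rightarrow> nat \<Rightarrow> nat \<Rightarrow> bool"
where
  "shock_state \<alpha> \<beta> \<gamma> b c x n k l \<longleftrightarrow>
     N_plus \<alpha> \<beta> \<gamma> b c x n = k \<and> N_minus \<alpha> \<beta> \<gamma> b c x n = l \<and>
     (\<forall>i\<in>{1..<n}. x i < \<alpha> + b (N_plus \<alpha> \<beta> \<gamma> b c x i) - c (N_minus \<alpha> \<beta> \<gamma> b c x i))"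

text \<open>Shocks are numbered from 1, so the first increment occurs between \<open>Suc 0\<close>
  and \<open>Suc (Suc 0)\<close>.\<close>

lemma N_minus_Suc:
  "N_minus \<alpha> \<beta> \<gamma> b c x (Suc (Suc n)) = N_minus \<alpha> \<beta> \<gamma> b c x (Suc n) +
     of_bool (x (Suc n) \<in> {\<beta>..<\<alpha> + b (N_plus \<alpha> \<beta> \<gamma> b c x (Suc n)) - c (N_minus \<alpha> \<beta> \<gamma> b c x (Suc n))})"
  by (subst N_minus.simps, subst sum.atLeastLessThan_Suc)
    (simp, rule arg_cong2[where f = plus, OF N_minus.simps[symmetric] refl])

lemma N_plus_Suc:
  "N_plus \<alpha> \<beta> \<gamma> b c x (Suc (Suc n)) = N_plus \<alpha> \<beta> \<gamma> b c x (Suc n) +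
     of_bool (x (Suc n) \<in> {\<gamma>..<\<beta>} \<and> N_minus \<alpha> \<beta> \<gamma> b c x (Suc n) = 0)"
  by (subst N_plus.simps, subst sum.atLeastLessThan_Suc)
    (simp, rule arg_cong2[where f = plus, OF N_plus.simps[symmetric] refl])

lemma shock_state_1: "shock_state \<alpha> \<beta> \<gamma> b c x (Suc 0) k l \<longleftrightarrow> k = 0 \<and> l = 0"
  by (auto simp: shock_state_def N_plus.simps[of _ _ _ _ _ _ "Suc 0"] N_minus.simps[of _ _ _ _ _ _ "Suc 0"])

text \<open>The weakening indicator needs no upper bound here: survival already puts the shock below
  the threshold of the previous state.\<close>

lemma shock_state_Suc:
  "shock_state \<alpha> \<beta> \<gamma> b c x (Suc (Suc n)) k l \<longleftrightarrow>
     (\<exists>k' l'. shock_state \<alpha> \<beta> \<gamma> b c x (Suc n) k' l' \<and> x (Suc n) < \<alpha> + b k' - c l' \<and>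
        k = k' + of_bool (x (Suc n) \<in> {\<gamma>..<\<beta>} \<and> l' = 0) \<and>
        l = l' + of_bool (\<beta> \<le> x (Suc n)))"
proof -
  have "{1..<Suc (Suc n)} = insert (Suc n) {1..<Suc n}"
    by auto
  then show ?thesis
    by (auto simp: shock_state_def N_minus_Suc N_plus_Suc)
qed

text \<open>All thresholds are at least \<beta>, so a shock below \<beta> is never fatal; before any
  weakening, a survived shock leaves both counters unchanged only if it is below \<gamma>.\<close>

lemma shock_state_Suc_0_0:
  assumes "\<gamma> \<le> \<beta>" "\<And>i j. \<beta> \<le> \<alpha> + b i - c j"
  shows "shock_state \<alpha> \<beta> \<gamma> b c x (Suc (Suc n)) 0 0 \<longleftrightarrow>
     shock_state \<alpha> \<beta> \<gamma> b c x (Suc n) 0 0 \<and> x (Suc n) < \<gamma>"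
proof -
  have not_fatal: "x (Suc n) < \<beta> \<Longrightarrow> x (Suc n) < \<alpha> + b i - c j" for i j
    using assms(2)[of i j] by linarith
  consider "x (Suc n) < \<gamma>" "x (Suc n) < \<beta>" | "\<gamma> \<le> x (Suc n)" "x (Suc n) < \<beta>" |
      "\<gamma> \<le> x (Suc n)" "\<beta> \<le> x (Suc n)"
    using assms(1) by linarith
  then show ?thesis
    by cases (auto simp: shock_state_Suc not_fatal)
qed

lemma shock_state_Suc_Suc_0:
  assumes "\<gamma> \<le> \<beta>" "\<And>i j. \<beta> \<le> \<alpha> + b i - c j"
  shows "shock_state \<alpha> \<beta> \<gamma> b c x (Suc (Suc n)) (Suc k) 0 \<longleftrightarrow>
     shock_state \<alpha> \<beta> \<gamma> b c x (Suc n) (Suc k) 0 \<and> x (Suc n) < \<gamma> \<or>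
     shock_state \<alpha> \<beta> \<gamma> b c x (Suc n) k 0 \<and> \<gamma> \<le> x (Suc n) \<and> x (Suc n) < \<beta>"
proof -
  have not_fatal: "x (Suc n) < \<beta> \<Longrightarrow> x (Suc n) < \<alpha> + b i - c j" for i j
    using assms(2)[of i j] by linarith
  consider "x (Suc n) < \<gamma>" "x (Suc n) < \<beta>" | "\<gamma> \<le> x (Suc n)" "x (Suc n) < \<beta>" |
      "\<gamma> \<le> x (Suc n)" "\<beta> \<le> x (Suc n)"
    using assms(1) by linarith
  then show ?thesis
    by cases (auto simp: shock_state_Suc not_fatal)
qed

text \<open>A positive weakening count switches strengthening off: the first counter is frozen,
  every shock below \<beta> is neutral, and \<gamma> drops out.\<close>

lemma shock_state_Suc_Suc:
  assumes "\<And>i j. \<beta> \<le> \<alpha> + b i - c j"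
  shows "shock_state \<alpha> \<beta> \<gamma> b c x (Suc (Suc n)) k (Suc l) \<longleftrightarrow>
     shock_state \<alpha> \<beta> \<gamma> b c x (Suc n) k (Suc l) \<and> x (Suc n) < \<beta> \<or>
     shock_state \<alpha> \<beta> \<gamma> b c x (Suc n) k l \<and> \<beta> \<le> x (Suc n) \<and> x (Suc n) < \<alpha> + b k - c l"
proof -
  have "x (Suc n) < \<beta> \<Longrightarrow> x (Suc n) < \<alpha> + b i - c j" for i j
    using assms[of i j] by linarith
  then show ?thesis
    by (cases "x (Suc n) < \<beta>") (auto simp: shock_state_Suc)
qed

text \<open>Minimality of the fatal index is the survival part of \<open>shock_state\<close>, and
  the counter values fix the threshold at \<open>n\<close>.\<close>

lemma first_fatal_eq_enat_iff:
  "first_fatal \<alpha> \<beta> \<gamma> b c x = enat n \<and> N_plus \<alpha> \<beta> \<gamma> b c x n = k \<and> N_minus \<alpha> \<beta> \<gamma> b c x n = l \<longleftrightarrow>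
     1 \<le> n \<and> shock_state \<alpha> \<beta> \<gamma> b c x n k l \<and> \<alpha> + b k - c l \<le> x n"
proof -
  define S where "S = {i. 1 \<le> i \<and>
     \<alpha> + b (N_plus \<alpha> \<beta> \<gamma> b c x i) - c (N_minus \<alpha> \<beta> \<gamma> b c x i) \<le> x i}"
  have S_iff: "i \<in> S \<longleftrightarrow> 1 \<le> i \<and>
      \<alpha> + b (N_plus \<alpha> \<beta> \<gamma> b c x i) - c (N_minus \<alpha> \<beta> \<gamma> b c x i) \<le> x i" for i
    by (simp add: S_def)
  have "Inf (enat ` S) = enat n \<longleftrightarrow> n \<in> S \<and> (\<forall>i<n. i \<notin> S)"
  proof
    assume eq: "Inf (enat ` S) = enat n"
    \<comment> \<open>The infimum of the empty set is \<infinity>, which is no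
      \<open>enat n\<close>. A nonempty set of \<open>enat\<close> contains its infimum.\<close>
    then have "enat ` S \<noteq> {}"
      by (metis Inf_empty enat.distinct(1) top_enat_def)
    then obtain s where "s \<in> enat ` S"
      by blast
    then have "Inf (enat ` S) \<in> enat ` S"
      by (rule wellorder_InfI)
    then have "n \<in> S"
      using eq by auto
    moreover have "n \<le> i" if "i \<in> S" for i
      using Inf_lower[of "enat i" "enat ` S"] that eq by simp
    ultimately show "n \<in> S \<and> (\<forall>i<n. i \<notin> S)"
      using not_le by blast
  next
    assume n: "n \<in> S \<and> (\<forall>i<n. i \<notin> S)"
    then have "enat n \<le> enat i" if "i \<in> S" for i
      using that not_le by auto
    with n show "Inf (enat ` S) = enat n"
      by (intro antisym Inf_lower Inf_greatest) auto
  qed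
  also have "\<dots> \<longleftrightarrow> 1 \<le> n \<and> \<alpha> + b (N_plus \<alpha> \<beta> \<gamma> b c x n) - c (N_minus \<alpha> \<beta> \<gamma> b c x n) \<le> x n \<and>
      (\<forall>i\<in>{1..<n}. x i < \<alpha> + b (N_plus \<alpha> \<beta> \<gamma> b c x i) - c (N_minus \<alpha> \<beta> \<gamma> b c x i))"
    by (auto simp: S_iff not_le)
  finally show ?thesis
    unfolding first_fatal_def S_def shock_state_def by auto
qed

section \<open>Events independent of all later shocks\<close>

locale iid_shocks = prob_space M for M :: "'a measure" +
  fixes X :: "nat \<Rightarrow> 'a \<Rightarrow> real"
  assumes indep: "indep_vars (\<lambda>_. borel) X {1..}"
    and identical: "\<And>i. 1 \<le> i \<Longrightarrow> distr M borel (X i) = distr M borel (X 1)"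
begin

abbreviation tail :: "real \<Rightarrow> real" where
  "tail \<equiv> tail_fun M (X 1)"

lemma X_measurable [measurable]: "1 \<le> i \<Longrightarrow> X i \<in> borel_measurable M"
  using indep by (auto simp: indep_vars_def)

lemma prob_X_eq: "1 \<le> i \<Longrightarrow> B \<in> sets borel \<Longrightarrow>
    prob (X i -` B \<inter> space M) = measure (distr M borel (X 1)) B"
  by (subst identical[symmetric]) (auto simp: measure_distr)

text \<open>Independence from all later shocks jointly, and not only from shock \<open>n\<close>, is what survives
  intersection with an event of shock \<open>n\<close>.\<close>

definition indep_from :: "nat \<Rightarrow> 'a set \<Rightarrow> bool" where
  "indep_from n A \<longleftrightarrow> A \<in> events \<and> (\<forall>J B. finite J \<longrightarrow> J \<subseteq> {n..} \<longrightarrow> (\<forall>j. B j \<in> sets borel) \<longrightarrow>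
     prob (A \<inter> {\<omega> \<in> space M. \<forall>j\<in>J. X j \<omega> \<in> B j}) =
     prob A * (\<Prod>j\<in>J. measure (distr M borel (X 1)) (B j)))"

lemma indep_fromD:
  "indep_from n A \<Longrightarrow> finite J \<Longrightarrow> J \<subseteq> {n..} \<Longrightarrow> (\<And>j. B j \<in> sets borel) \<Longrightarrow>
     prob (A \<inter> {\<omega> \<in> space M. \<forall>j\<in>J. X j \<omega> \<in> B j}) =
     prob A * (\<Prod>j\<in>J. measure (distr M borel (X 1)) (B j))"
  by (auto simp: indep_from_def)

lemma indep_from_empty: "indep_from n {}"
  by (simp add: indep_from_def)

lemma indep_from_space: "indep_from (Suc 0) (space M)"
  unfolding indep_from_def
proof (intro conjI allI impI)
  fix J and B :: "nat \<Rightarrow> real set"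
  assume J: "finite J" "J \<subseteq> {Suc 0..}" and B: "\<forall>j. B j \<in> sets borel"
  show "prob (space M \<inter> {\<omega> \<in> space M. \<forall>j\<in>J. X j \<omega> \<in> B j}) =
      prob (space M) * (\<Prod>j\<in>J. measure (distr M borel (X 1)) (B j))"
  \<comment> \<open>The empty \<open>J\<close> is treated apart because an intersection over no
    index is \<open>UNIV\<close> instead of \<open>space M\<close>.\<close>
  proof (cases "J = {}")
    case False
    have "space M \<inter> {\<omega> \<in> space M. \<forall>j\<in>J. X j \<omega> \<in> B j} = (\<Inter>j\<in>J. X j -` B j \<inter> space M)"
      using False by auto
    also have "prob \<dots> = (\<Prod>j\<in>J. prob (X j -` B j \<inter> space M))"
      using J B False by (intro indep_varsD[OF indep]) auto
    also have "\<dots> = (\<Prod>j\<in>J. measure (distr M borel (X 1)) (B j))"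
      using J B by (intro prod.cong refl prob_X_eq) auto
    finally show ?thesis
      by (simp add: prob_space)
  qed (simp add: prob_space)
qed simp

lemma prob_indep_from_Int:
  assumes A: "indep_from n A" and "B \<in> sets borel"
  shows "prob (A \<inter> {\<omega> \<in> space M. X n \<omega> \<in> B}) = prob A * measure (distr M borel (X 1)) B"
  using indep_fromD[OF A, of "{n}" "\<lambda>_. B"] assms by simp

lemma indep_from_Int:
  assumes A: "indep_from n A" and n: "1 \<le> n" and B: "B \<in> sets borel"
  shows "indep_from (Suc n) (A \<inter> {\<omega> \<in> space M. X n \<omega> \<in> B})"
  unfolding indep_from_def
proof (intro conjI allI impI)
  have [measurable]: "X n \<in> borel_measurable M"
    using n by simp
  show "A \<inter> {\<omega> \<in> space M. X n \<omega> \<in> B} \<in> events"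
    using A B by (intro sets.Int) (auto simp: indep_from_def)
  fix J and C :: "nat \<Rightarrow> real set"
  assume J: "finite J" "J \<subseteq> {Suc n..}" and C: "\<forall>j. C j \<in> sets borel"
  \<comment> \<open>Placing \<open>B\<close> in slot \<open>n\<close> merges the new condition with
    those on \<open>J\<close> into one product event over \<open>insert n J\<close>, to which the
    independence of \<open>A\<close> applies.\<close>
  define D where "D = C(n := B)"
  have "n \<notin> J"
    using J by auto
  then have "A \<inter> {\<omega> \<in> space M. X n \<omega> \<in> B} \<inter> {\<omega> \<in> space M. \<forall>j\<in>J. X j \<omega> \<in> C j} =
      A \<inter> {\<omega> \<in> space M. \<forall>j\<in>insert n J. X j \<omega> \<in> D j}"
    by (auto simp: D_def)
  also have "prob \<dots> = prob A * (\<Prod>j\<in>insert n J. measure (distr M borel (X 1)) (D j))"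
    using J B C by (intro indep_fromD[OF A]) (auto simp: D_def)
  also have "(\<Prod>j\<in>insert n J. measure (distr M borel (X 1)) (D j)) =
      measure (distr M borel (X 1)) B * (\<Prod>j\<in>J. measure (distr M borel (X 1)) (D j))"
    using J \<open>n \<notin> J\<close> by (simp add: D_def)
  also have "(\<Prod>j\<in>J. measure (distr M borel (X 1)) (D j)) = (\<Prod>j\<in>J. measure (distr M borel (X 1)) (C j))"
    using \<open>n \<notin> J\<close> by (intro prod.cong) (auto simp: D_def)
  finally show "prob (A \<inter> {\<omega> \<in> space M. X n \<omega> \<in> B} \<inter> {\<omega> \<in> space M. \<forall>j\<in>J. X j \<omega> \<in> C j}) =
      prob (A \<inter> {\<omega> \<in> space M. X n \<omega> \<in> B}) * (\<Prod>j\<in>J. measure (distr M borel (X 1)) (C j))"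
    by (simp add: prob_indep_from_Int[OF A B])
qed

text \<open>Both sides of the product formula are additive over disjoint sets.
  \<open>1 \<le> n\<close> keeps the index 0, at which \<open>X\<close> need not be measurable, out
  of \<open>J\<close>.\<close>

lemma indep_from_Un:
  assumes A: "indep_from n A" and B: "indep_from n B" and "A \<inter> B = {}" and n: "1 \<le> n"
  shows "indep_from n (A \<union> B)"
  unfolding indep_from_def
proof (intro conjI allI impI)
  have ev: "A \<in> events" "B \<in> events"
    using A B by (auto simp: indep_from_def)
  then show "A \<union> B \<in> events"
    by simp
  fix J and C :: "nat \<Rightarrow> real set"
  assume J: "finite J" "J \<subseteq> {n..}" and C: "\<forall>j. C j \<in> sets borel"
  let ?E = "{\<omega> \<in> space M. \<forall>j\<in>J. X j \<omega> \<in> C j}"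
  have [measurable]: "C j \<in> sets borel" for j
    using C by simp
  have [measurable]: "j \<in> J \<Longrightarrow> X j \<in> borel_measurable M" for j
    using J n by (intro X_measurable) auto
  have [simp]: "?E \<in> events"
    using J(1) by measurable
  have "prob ((A \<union> B) \<inter> ?E) = prob (A \<inter> ?E) + prob (B \<inter> ?E)"
    using ev assms(3) by (subst finite_measure_Union[symmetric]) (auto intro!: arg_cong[of _ _ prob])
  moreover have "prob (A \<union> B) = prob A + prob B"
    using ev assms(3) by (intro finite_measure_Union) auto
  ultimately show "prob ((A \<union> B) \<inter> ?E) = prob (A \<union> B) * (\<Prod>j\<in>J. measure (distr M borel (X 1)) (C j))"
    using indep_fromD[OF A J] indep_fromD[OF B J] C by (simp add: algebra_simps)
qed

section \<open>The common law in terms of the tail\<close>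

lemma law_lessThan: "measure (distr M borel (X 1)) {..<x} = 1 - tail x"
  by (subst prob_X_eq[of 1, symmetric]) (auto simp: tail_fun_def dist_fun_def vimage_def Int_def conj_commute)

lemma law_atLeast: "measure (distr M borel (X 1)) {x..} = tail x"
proof -
  interpret D: prob_space "distr M borel (X 1)"
    by (intro prob_space_distr) simp
  have "measure (distr M borel (X 1)) {x..} = 1 - measure (distr M borel (X 1)) {..<x}"
    using D.prob_compl[of "{..<x}"] by (simp add: Compl_eq_Diff_UNIV[symmetric])
  then show ?thesis
    by (simp only: law_lessThan)
qed

lemma law_atLeastLessThan:
  assumes "x \<le> y"
  shows "measure (distr M borel (X 1)) {x..<y} = tail x - tail y"
proof -
  interpret D: prob_space "distr M borel (X 1)"
    by (intro prob_space_distr) simp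
  have "{x..<y} = {x..} - {y..}"
    by auto
  also have "D.prob \<dots> = D.prob {x..} - D.prob {y..}"
    using assms by (intro D.finite_measure_Diff) auto
  finally show ?thesis
    by (simp only: law_atLeast)
qed

lemma tail_antimono: "x \<le> y \<Longrightarrow> tail y \<le> tail x"
  using law_atLeastLessThan[of x y] measure_nonneg[of "distr M borel (X 1)" "{x..<y}"] by linarith

lemma tail_le_1: "tail x \<le> 1"
  using law_lessThan[of x] measure_nonneg[of "distr M borel (X 1)" "{..<x}"] by linarith

end

section \<open>State probabilities at a fixed \<open>t\<close>\<close>

locale extreme_shock_model = iid_shocks +
  fixes \<alpha> \<beta> \<gamma> :: real and b c :: "nat \<Rightarrow> real"
  assumes \<gamma>_le_\<beta>: "\<gamma> \<le> \<beta>"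
    and threshold_ge: "\<And>i j. \<beta> \<le> \<alpha> + b i - c j"
    and tail_\<beta>_pos: "tail \<beta> > 0"
begin

text \<open>The index is shifted: \<open>n\<close> is the number of shocks that have already occurred.\<close>

definition state_event :: "nat \<Rightarrow> nat \<Rightarrow> nat \<Rightarrow> 'a set" where
  "state_event k l n = {\<omega> \<in> space M. shock_state \<alpha> \<beta> \<gamma> b c (\<lambda>i. X i \<omega>) (Suc n) k l}"

lemma state_event_start: "state_event k l 0 = (if k = 0 \<and> l = 0 then space M else {})"
  by (auto simp: state_event_def shock_state_1)

lemma state_event_0_0:
  "state_event 0 0 (Suc n) = state_event 0 0 n \<inter> {\<omega> \<in> space M. X (Suc n) \<omega> \<in> {..<\<gamma>}}"
  by (auto simp: state_event_def shock_state_Suc_0_0 \<gamma>_le_\<beta> threshold_ge)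

lemma state_event_Suc_0:
  "state_event (Suc k) 0 (Suc n) =
     state_event (Suc k) 0 n \<inter> {\<omega> \<in> space M. X (Suc n) \<omega> \<in> {..<\<gamma>}} \<union>
     state_event k 0 n \<inter> {\<omega> \<in> space M. X (Suc n) \<omega> \<in> {\<gamma>..<\<beta>}}"
  by (auto simp: state_event_def shock_state_Suc_Suc_0 \<gamma>_le_\<beta> threshold_ge)

lemma state_event_Suc:
  "state_event k (Suc l) (Suc n) =
     state_event k (Suc l) n \<inter> {\<omega> \<in> space M. X (Suc n) \<omega> \<in> {..<\<beta>}} \<union>
     state_event k l n \<inter> {\<omega> \<in> space M. X (Suc n) \<omega> \<in> {\<beta>..<\<alpha> + b k - c l}}"
  by (auto simp: state_event_def shock_state_Suc_Suc threshold_ge)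

text \<open>Induction with \<open>k\<close> and \<open>l\<close> free, since the last shock may have
  changed the state. The two pieces of each union are disjoint because they put that shock into
  disjoint intervals.\<close>

lemma indep_from_state_event: "indep_from (Suc n) (state_event k l n)"
proof (induction n arbitrary: k l)
  case 0
  show ?case
    by (simp add: state_event_start indep_from_space indep_from_empty)
next
  case (Suc n)
  consider "k = 0" "l = 0" | k' where "k = Suc k'" "l = 0" | l' where "l = Suc l'"
    by (metis not0_implies_Suc)
  then show ?case
  proof cases
    case 1
    then show ?thesis
      by (auto simp only: state_event_0_0 intro!: indep_from_Int Suc) auto
  next
    case 2
    show ?thesis
      unfolding 2 state_event_Suc_0 by (intro indep_from_Un indep_from_Int Suc) auto
  next
    case 3
    show ?thesis
      unfolding 3 state_event_Suc by (intro indep_from_Un indep_from_Int Suc) auto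
  qed
qed

lemma prob_state_event_Int:
  "B \<in> sets borel \<Longrightarrow> prob (state_event k l n \<inter> {\<omega> \<in> space M. X (Suc n) \<omega> \<in> B}) =
     prob (state_event k l n) * measure (distr M borel (X 1)) B"
  by (rule prob_indep_from_Int[OF indep_from_state_event])

lemma state_event_Int_in_events [simp]:
  "B \<in> sets borel \<Longrightarrow> state_event k l n \<inter> {\<omega> \<in> space M. X (Suc n) \<omega> \<in> B} \<in> events"
  using indep_from_Int[OF indep_from_state_event, of n B k l] by (simp add: indep_from_def)

lemma prob_state_event_0_0:
  "prob (state_event 0 0 (Suc n)) = (1 - tail \<gamma>) * prob (state_event 0 0 n)"
  by (simp only: state_event_0_0 prob_state_event_Int borel_open open_lessThan law_lessThan mult.commute)

lemma prob_state_event_Suc_0: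
  "prob (state_event (Suc k) 0 (Suc n)) =
     (1 - tail \<gamma>) * prob (state_event (Suc k) 0 n) + (tail \<gamma> - tail \<beta>) * prob (state_event k 0 n)"
proof -
  have "prob (state_event (Suc k) 0 (Suc n)) =
      prob (state_event (Suc k) 0 n \<inter> {\<omega> \<in> space M. X (Suc n) \<omega> \<in> {..<\<gamma>}}) +
      prob (state_event k 0 n \<inter> {\<omega> \<in> space M. X (Suc n) \<omega> \<in> {\<gamma>..<\<beta>}})"
    unfolding state_event_Suc_0
    by (rule finite_measure_Union; (rule state_event_Int_in_events)?) auto
  then show ?thesis
    by (simp only: prob_state_event_Int borel_open open_lessThan atLeastLessThan_borel
        law_lessThan law_atLeastLessThan[OF \<gamma>_le_\<beta>] mult.commute)
qed

text \<open>After a weakening the chance of staying is \<open>1 - tail \<beta>\<close>, since shocks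
  in \<open>{\<gamma>..<\<beta>}\<close> are neutral. Hence the weakening factors below have
  denominator \<open>tail \<beta>\<close>.\<close>

lemma prob_state_event_Suc:
  "prob (state_event k (Suc l) (Suc n)) =
     (1 - tail \<beta>) * prob (state_event k (Suc l) n) +
     (tail \<beta> - tail (\<alpha> + b k - c l)) * prob (state_event k l n)"
proof -
  have "prob (state_event k (Suc l) (Suc n)) =
      prob (state_event k (Suc l) n \<inter> {\<omega> \<in> space M. X (Suc n) \<omega> \<in> {..<\<beta>}}) +
      prob (state_event k l n \<inter> {\<omega> \<in> space M. X (Suc n) \<omega> \<in> {\<beta>..<\<alpha> + b k - c l}})"
    unfolding state_event_Suc
    by (rule finite_measure_Union; (rule state_event_Int_in_events)?) auto
  then show ?thesis
    by (simp only: prob_state_event_Int borel_open open_lessThan atLeastLessThan_borel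
        law_lessThan law_atLeastLessThan[OF threshold_ge] mult.commute)
qed

lemma tail_\<gamma>_pos: "tail \<gamma> > 0"
  using tail_antimono[OF \<gamma>_le_\<beta>] tail_\<beta>_pos by linarith

text \<open>The sum is the expected time spent in state \<open>(k, 0)\<close> before the fatal
  shock. For \<open>k = 0\<close> it is a geometric series; each strengthening contributes the
  chance that a shock of at least \<gamma> is below \<beta>.\<close>

lemma prob_state_event_0_sums:
  "(\<lambda>n. prob (state_event k 0 n)) sums ((1 - tail \<beta> / tail \<gamma>) ^ k / tail \<gamma>)"
proof (induction k)
  case 0
  have "(\<lambda>n. prob (state_event 0 0 n)) sums ((prob (state_event 0 0 0) + 0) / (1 - (1 - tail \<gamma>)))"
    by (rule sums_affine_recursion[where v = "\<lambda>_. 0"])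
      (use tail_\<gamma>_pos tail_le_1[of \<gamma>] in \<open>simp_all add: prob_state_event_0_0\<close>)
  then show ?case
    by (simp add: state_event_start prob_space)
next
  case (Suc k)
  \<comment> \<open>The initial term vanishes, because the process starts in state
    \<open>(0, 0)\<close>.\<close>
  have "(\<lambda>n. prob (state_event (Suc k) 0 n)) sums ((prob (state_event (Suc k) 0 0) +
      (tail \<gamma> - tail \<beta>) * ((1 - tail \<beta> / tail \<gamma>) ^ k / tail \<gamma>)) / (1 - (1 - tail \<gamma>)))"
    by (rule sums_affine_recursion[OF _ _ _ _ sums_mult[OF Suc] prob_state_event_Suc_0])
      (use tail_\<gamma>_pos tail_le_1[of \<gamma>] tail_antimono[OF \<gamma>_le_\<beta>] in simp_all)
  then show ?case
    using tail_\<gamma>_pos by (simp add: state_event_start field_simps)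
qed

text \<open>Each weakening contributes the chance that a shock of at least \<beta> stays below the
  current threshold.\<close>

lemma prob_state_event_sums:
  "(\<lambda>n. prob (state_event k l n)) sums
     ((1 - tail \<beta> / tail \<gamma>) ^ k / tail \<gamma> * (\<Prod>h<l. 1 - tail (\<alpha> + b k - c h) / tail \<beta>))"
proof (induction l)
  case 0
  show ?case
    using prob_state_event_0_sums by simp
next
  case (Suc l)
  let ?U = "(1 - tail \<beta> / tail \<gamma>) ^ k / tail \<gamma> * (\<Prod>h<l. 1 - tail (\<alpha> + b k - c h) / tail \<beta>)"
  have "(\<lambda>n. prob (state_event k (Suc l) n)) sums ((prob (state_event k (Suc l) 0) +
      (tail \<beta> - tail (\<alpha> + b k - c l)) * ?U) / (1 - (1 - tail \<beta>)))"
    by (rule sums_affine_recursion[OF _ _ _ _ sums_mult[OF Suc] prob_state_event_Suc])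
      (use tail_\<beta>_pos tail_le_1[of \<beta>] tail_antimono[OF threshold_ge] in simp_all)
  also have "(prob (state_event k (Suc l) 0) +
      (tail \<beta> - tail (\<alpha> + b k - c l)) * ?U) / (1 - (1 - tail \<beta>)) =
      ?U * (1 - tail (\<alpha> + b k - c l) / tail \<beta>)"
    using tail_\<beta>_pos by (simp add: state_event_start diff_divide_distrib left_diff_distrib right_diff_distrib)
  finally show ?case
    by (simp add: mult.assoc)
qed

text \<open>The fatal shock is independent of the state it meets, so the expected time in
  \<open>(k, l)\<close> is multiplied by the tail at the threshold of that state.\<close>

theorem prob_state_at_first_fatal:
  "prob {\<omega> \<in> space M. \<exists>n. first_fatal \<alpha> \<beta> \<gamma> b c (\<lambda>i. X i \<omega>) = enat n \<and>
       N_plus \<alpha> \<beta> \<gamma> b c (\<lambda>i. X i \<omega>) n = k \<and> N_minus \<alpha> \<beta> \<gamma> b c (\<lambda>i. X i \<omega>) n = l} =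
     tail \<beta> / tail \<gamma> * (1 - tail \<beta> / tail \<gamma>) ^ k *
     (\<Prod>h<l. 1 - tail (\<alpha> + b k - c h) / tail \<beta>) * (tail (\<alpha> + b k - c l) / tail \<beta>)"
    (is "prob ?E = ?P")
proof -
  define A where "A n = state_event k l n \<inter> {\<omega> \<in> space M. X (Suc n) \<omega> \<in> {\<alpha> + b k - c l..}}" for n
  have A_iff: "\<omega> \<in> A n \<longleftrightarrow> \<omega> \<in> space M \<and> first_fatal \<alpha> \<beta> \<gamma> b c (\<lambda>i. X i \<omega>) = enat (Suc n) \<and>
       N_plus \<alpha> \<beta> \<gamma> b c (\<lambda>i. X i \<omega>) (Suc n) = k \<and> N_minus \<alpha> \<beta> \<gamma> b c (\<lambda>i. X i \<omega>) (Suc n) = l" for \<omega> n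
    unfolding first_fatal_eq_enat_iff by (auto simp: A_def state_event_def)
  have "?E = (\<Union>n. A n)"
  proof -
    \<comment> \<open>The sets \<open>A n\<close> only cover the indices \<open>Suc n\<close>, so
      the value 0 must be excluded.\<close>
    have "1 \<le> n" if "first_fatal \<alpha> \<beta> \<gamma> b c x = enat n" for x n
      using that first_fatal_eq_enat_iff by blast
    then show ?thesis
      by (auto simp: A_iff) (metis One_nat_def Suc_le_D)
  qed
  moreover have "(\<lambda>n. prob (A n)) sums prob (\<Union>n. A n)"
  proof (rule finite_measure_UNION)
    show "range A \<subseteq> events"
      unfolding A_def by (intro image_subsetI state_event_Int_in_events) simp
    show "disjoint_family A"
      by (auto simp: disjoint_family_on_def A_iff)
  qed
  moreover have "prob (A n) = prob (state_event k l n) * tail (\<alpha> + b k - c l)" for n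
    unfolding A_def by (simp only: prob_state_event_Int borel_closed closed_atLeast law_atLeast)
  \<comment> \<open>The factor \<open>1 / tail \<gamma>\<close> is split into
    \<open>tail \<beta> / tail \<gamma>\<close> and \<open>1 / tail \<beta>\<close>; the latter
    joins the tail at the threshold, so that only ratios with known limits remain.\<close>
  moreover have "(\<lambda>n. prob (state_event k l n) * tail (\<alpha> + b k - c l)) sums ?P"
    using sums_mult2[OF prob_state_event_sums[of k l], of "tail (\<alpha> + b k - c l)"] tail_\<beta>_pos
    by (simp add: mult_ac)
  ultimately show ?thesis
    using sums_unique2 by fastforce
qed

end

section \<open>Passage to the limit\<close>

theorem theorem1:
  fixes M :: "'a measure"
    and X :: "nat \<Rightarrow> 'a \<Rightarrow> real"
    and \<alpha> \<beta> \<gamma> :: "real \<Rightarrow> real"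
    and b c :: "real \<Rightarrow> nat \<Rightarrow> real"
    and g :: real
    and a :: "nat \<Rightarrow> nat \<Rightarrow> real"
    and k l :: nat
  assumes "prob_space M"
    and "prob_space.indep_vars M (\<lambda>_. borel) X {1..}"
    and "\<And>i. 1 \<le> i \<Longrightarrow> distr M borel (X i) = distr M borel (X 1)"
    and "\<And>x. ereal x = upper_endpoint M (X 1) \<Longrightarrow> isCont (dist_fun M (X 1)) x"
    and "\<And>t. \<gamma> t \<le> \<beta> t"
    and "\<And>t. \<beta> t \<le> \<alpha> t"
    and "\<And>t. tail_fun M (X 1) (\<beta> t) > 0"
    and "((\<lambda>t. ereal (\<alpha> t)) \<longlongrightarrow> upper_endpoint M (X 1)) at_top"
    and "((\<lambda>t. ereal (\<beta> t)) \<longlongrightarrow> upper_endpoint M (X 1)) at_top"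
    and "((\<lambda>t. ereal (\<gamma> t)) \<longlongrightarrow> upper_endpoint M (X 1)) at_top"
    and "\<And>t. mono (b t)"
    and "\<And>t. mono (c t)"
    and "\<And>t. b t 0 = 0"
    and "\<And>t. c t 0 = 0"
    and "\<And>t. b t 1 > 0"
    and "\<And>t i j. \<beta> t \<le> \<alpha> t + b t i - c t j"
    and "g \<in> {0..1}"
    and "\<And>i j. a i j \<in> {0..1}"
    and "((\<lambda>t. tail_fun M (X 1) (\<beta> t) / tail_fun M (X 1) (\<gamma> t)) \<longlongrightarrow> g) at_top"
    and "\<And>i j. ((\<lambda>t. tail_fun M (X 1) (\<alpha> t + b t i - c t j) / tail_fun M (X 1) (\<beta> t))
            \<longlongrightarrow> a i j) at_top"
  shows "((\<lambda>t. measure M {\<omega> \<in> space M. \<exists>n.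
              first_fatal (\<alpha> t) (\<beta> t) (\<gamma> t) (b t) (c t) (\<lambda>i. X i \<omega>) = enat n \<and>
              N_plus (\<alpha> t) (\<beta> t) (\<gamma> t) (b t) (c t) (\<lambda>i. X i \<omega>) n = k \<and>
              N_minus (\<alpha> t) (\<beta> t) (\<gamma> t) (b t) (c t) (\<lambda>i. X i \<omega>) n = l})
          \<longlongrightarrow> g * (1 - g) ^ k * (\<Prod>h<l. 1 - a k h) * a k l) at_top"
proof -
  have exact: "measure M {\<omega> \<in> space M. \<exists>n.
        first_fatal (\<alpha> t) (\<beta> t) (\<gamma> t) (b t) (c t) (\<lambda>i. X i \<omega>) = enat n \<and>
        N_plus (\<alpha> t) (\<beta> t) (\<gamma> t) (b t) (c t) (\<lambda>i. X i \<omega>) n = k \<and>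
        N_minus (\<alpha> t) (\<beta> t) (\<gamma> t) (b t) (c t) (\<lambda>i. X i \<omega>) n = l} =
      tail_fun M (X 1) (\<beta> t) / tail_fun M (X 1) (\<gamma> t) *
      (1 - tail_fun M (X 1) (\<beta> t) / tail_fun M (X 1) (\<gamma> t)) ^ k *
      (\<Prod>h<l. 1 - tail_fun M (X 1) (\<alpha> t + b t k - c t h) / tail_fun M (X 1) (\<beta> t)) *
      (tail_fun M (X 1) (\<alpha> t + b t k - c t l) / tail_fun M (X 1) (\<beta> t))" for t
  proof -
    interpret prob_space M
      by fact
    interpret extreme_shock_model M X "\<alpha> t" "\<beta> t" "\<gamma> t" "b t" "c t"
      by unfold_locales (fact assms)+
    show ?thesis
      by (rule prob_state_at_first_fatal)
  qed
  \<comment> \<open>Powers and finite products are continuous, so the limits of the ratios suffice.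
    In HOL too \<open>0 ^ 0 = 1\<close>, which agrees with the convention when \<open>g = 1\<close>
    and \<open>k = 0\<close>.\<close>
  show ?thesis
    unfolding exact by (intro tendsto_intros assms)
qed

end
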